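(* Let $d,m\ge1$. If a periodic form $X\in\mathcal{S}^{d,m}_{>0}$ is $m$-perfect and $m$-eutactic, then $X$ is isolated $m$-extreme.
   Context: **Spaces.** $\mathcal{S}^d$ is the space of real symmetric $d\times d$ matrices with inner product $\langle Q,Q'\rangle=\mathrm{trace}(QQ')$; $\mathcal{S}^d_{>0}$ is the subset of positive definite matrices; $Q[\vec{x}]=\vec{x}^tQ\vec{x}$. Let $\mathcal{S}^{d,m}=\mathcal{S}^d\times\mathbb{R}^{d\times(m-1)}$, a Euclidean space with inner product $\langle(Q,\vec{t}),(Q',\vec{t}')\rangle=\langle Q,Q'\rangle+\sum_{i=1}^{m-1}\vec{t}_i^t\vec{t}'_i$, and $\mathcal{S}^{d,m}_{>0}=\mathcal{S}^d_{>0}\times\mathbb{R}^{d\times(m-1)}$. Elements $X=(Q,\vec{t})\in\mathcal{S}^{d,m}_{>0}$, $\vec{t}=(\vec{t}_1,\dots,\vec{t}_{m-1})$, are called periodic forms; by convention $\vec{t}_m=\vec{0}$. **Minimum and density.** The generalized arithmetical minimum is $$\lambda(X)=\min\{Q[\vec{t}_i-\vec{t}_j-\vec{v}] : 1\le i,j\le m,\ \vec{v}\in\mathbb{Z}^d,\ \vec{v}\ne\vec{0}\text{ if } i=j\},$$ and $\mathrm{Min}\,X$ is the set of all vectors $\vec{w}=\vec{t}_i-\vec{t}_j-\vec{v}$ (with $i,j,\vec{v}$ as in this definition) attaining it. With $\det X=\det Q$ and $B^d$ the unit ball in $\mathbb{R}^d$, $$\delta(X)=\left(\frac{\lambda(X)}{(\det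 X)^{1/d}}\right)^{d/2}\frac{m\,\mathrm{vol}\,B^d}{2^d}.$$ **Generalized Voronoi domain.** For $1\le i,j\le m$ and $\vec{v}\in\mathbb{Z}^d$ let $p_{i,j,\vec{v}}(X)=Q[\vec{t}_i-\vec{t}_j-\vec{v}]$. Its gradient at $X$, with $\vec{w}=\vec{t}_i-\vec{t}_j-\vec{v}$, is the element of $\mathcal{S}^{d,m}$ whose $\mathcal{S}^d$-component is $\vec{w}\vec{w}^t$ and whose translational component has $i$th column $2Q\vec{w}$, $j$th column $-2Q\vec{w}$ and all other columns $\vec{0}$ (a column with index $m$ is omitted; if $i=j$ all columns are $\vec{0}$). The generalized Voronoi domain $\mathcal{V}(X)\subset\mathcal{S}^{d,m}$ is the conic hull (set of finite nonnegative linear combinations) of all $(\mathrm{grad}\,p_{i,j,\vec{v}})(X)$ with $\vec{t}_i-\vec{t}_j-\vec{v}\in\mathrm{Min}\,X$ ($1\le i,j\le m$, $\vec{v}\in\mathbb{Z}^d$, and $\vec{v}\neq\vec{0}$ if $i=j$). **Properties.** - $X$ is *$m$-perfect* if $\mathcal{V}(X)$ is full-dimensional, i.e. $\dim\mathcal{V}(X)=\dim\mathcal{S}^{d,m}=\binom{d+1}{2}+(m-1)d$. - $X=(Q,\vec{t})$ is *$m$-eutactic* if $(Q^{-1},\vec{0})$ lies in the relative interior of $\mathcal{V}(X)$. - $X$ is *isolated $m$-extreme* if any sufficiently small change of $X$ that preserves $\lambda(X)$ necessarily lowers $\delta(X)$: there is a neighborhood $W$ of $X$ in $\mathcal{S}^{d,m}_{>0}$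 such that $\delta(X')<\delta(X)$ for all $X'\in W$ with $X'\neq X$ and $\lambda(X')=\lambda(X)$. *)

theory Defs
  imports "HOL-Analysis.Analysis"
begin

text \<open>
  The dimension is \<open>d = CARD('d)\<close>, and \<open>m = CARD('m)\<close>. All \<open>m\<close> translation vectors are
  stored in one vector indexed by \<open>'m\<close>; a distinguished index \<open>l :: 'm\<close> plays the role of
  the index \<open>m\<close>, and the convention \<open>t\<^sub>m = 0\<close> becomes the requirement \<open>t $ l = 0\<close>.
  In this way \<open>S\<^sup>d\<^sup>,\<^sup>m\<close> is a linear subspace of a Euclidean space type, and its inner product
  is the restriction of the ambient one (see \<open>inner_periodic_space\<close> below).
\<close>

definition periodic_space :: "'m::finite \<Rightarrow> ((real^'d::finite^'d) \<times> (real^'d^'m)) set" where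
  "periodic_space l = {(Q, t). transpose Q = Q \<and> t $ l = 0}"

definition qform :: "real^'d::finite^'d \<Rightarrow> real^'d \<Rightarrow> real" where
  "qform Q x = x \<bullet> (Q *v x)"

definition periodic_forms :: "'m::finite \<Rightarrow> ((real^'d::finite^'d) \<times> (real^'d^'m)) set" where
  "periodic_forms l = {(Q, t) \<in> periodic_space l. \<forall>x. x \<noteq> 0 \<longrightarrow> qform Q x > 0}"

definition int_vecs :: "(real^'d::finite) set" where
  "int_vecs = {v. \<forall>k. v $ k \<in> \<int>}"

definition admissible :: "'m::finite \<Rightarrow> 'm \<Rightarrow> real^'d::finite \<Rightarrow> bool" where
  "admissible i j v \<longleftrightarrow> v \<in> int_vecs \<and> (i = j \<longrightarrow> v \<noteq> 0)"

definition diff_vec :: "(real^'d::finite^'d) \<times> (real^'d^'m::finite) \<Rightarrow> 'm \<Rightarrow> 'm \<Rightarrow> real^'d \<Rightarrow> real^'d" where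
  "diff_vec X i j v = snd X $ i - snd X $ j - v"

definition pval :: "'m::finite \<Rightarrow> 'm \<Rightarrow> real^'d::finite \<Rightarrow> (real^'d^'d) \<times> (real^'d^'m) \<Rightarrow> real" where
  "pval i j v X = qform (fst X) (diff_vec X i j v)"

text \<open>For periodic forms the minimum exists, see \<open>gen_min_attained\<close> below.\<close>

definition gen_min :: "(real^'d::finite^'d) \<times> (real^'d^'m::finite) \<Rightarrow> real" where
  "gen_min X = (LEAST r. \<exists>i j v. admissible i j v \<and> r = pval i j v X)"

definition Min_vecs :: "(real^'d::finite^'d) \<times> (real^'d^'m::finite) \<Rightarrow> (real^'d) set" where
  "Min_vecs X = {diff_vec X i j v | i j v. admissible i j v \<and> pval i j v X = gen_min X}"

definition density :: "(real^'d::finite^'d) \<times> (real^'d^'m::finite) \<Rightarrow> real" where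
  "density X =
     (gen_min X / det (fst X) powr (1 / real CARD('d))) powr (real CARD('d) / 2)
       * (real CARD('m) * measure lborel (cball (0 :: real^'d) 1) / 2 ^ CARD('d))"

text \<open>
  The gradient is taken inside \<open>S\<^sup>d\<^sup>,\<^sup>m\<close>, so its column with index \<open>l\<close> vanishes. The lemmas
  \<open>pgrad_in_periodic_space\<close> and \<open>has_derivative_pval\<close> below justify the formula.
\<close>

definition pgrad :: "'m::finite \<Rightarrow> 'm \<Rightarrow> 'm \<Rightarrow> real^'d::finite \<Rightarrow> (real^'d^'d) \<times> (real^'d^'m)
    \<Rightarrow> (real^'d^'d) \<times> (real^'d^'m)" where
  "pgrad l i j v X =
     (let w = diff_vec X i j v; u = 2 *\<^sub>R (fst X *v w) in
       (\<chi> a b. w $ a * w $ b,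
        \<chi> k. if k = l then 0 else (if k = i then u else 0) - (if k = j then u else 0)))"

text \<open>
  The set of finite nonnegative linear combinations is \<open>convex_cone hull\<close>; the library's
  \<open>conic hull\<close> only takes the union of rays. As this cone contains \<open>0\<close>, its dimension is
  the dimension of its linear span; for the dimension of the ambient space
  see \<open>dim_periodic_space\<close> below.
\<close>

definition voronoi_domain :: "'m::finite \<Rightarrow> (real^'d::finite^'d) \<times> (real^'d^'m)
    \<Rightarrow> ((real^'d^'d) \<times> (real^'d^'m)) set" where
  "voronoi_domain l X =
     convex_cone hull {pgrad l i j v X | i j v. admissible i j v \<and> diff_vec X i j v \<in> Min_vecs X}"

definition m_perfect :: "'m::finite \<Rightarrow> (real^'d::finite^'d) \<times> (real^'d^'m) \<Rightarrow> bool" where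
  "m_perfect l X \<longleftrightarrow>
     dim (voronoi_domain l X) = dim (periodic_space l :: ((real^'d^'d) \<times> (real^'d^'m)) set)"

definition m_eutactic :: "'m::finite \<Rightarrow> (real^'d::finite^'d) \<times> (real^'d^'m) \<Rightarrow> bool" where
  "m_eutactic l X \<longleftrightarrow> (matrix_inv (fst X), 0) \<in> rel_interior (voronoi_domain l X)"

definition isolated_m_extreme :: "'m::finite \<Rightarrow> (real^'d::finite^'d) \<times> (real^'d^'m) \<Rightarrow> bool" where
  "isolated_m_extreme l X \<longleftrightarrow>
     (\<exists>W. openin (top_of_set (periodic_forms l)) W \<and> X \<in> W \<and>
        (\<forall>X'\<in>W. X' \<noteq> X \<and> gen_min X' = gen_min X \<longrightarrow> density X' < density X))"

lemma inner_periodic_space: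
  assumes "(Q, t) \<in> periodic_space l" "(Q', t') \<in> periodic_space l"
  shows "(Q, t) \<bullet> (Q', t') = trace (Q ** Q') + (\<Sum>i\<in>UNIV - {l}. t $ i \<bullet> t' $ i)"
proof -
  have s: "transpose Q' = Q'" "t $ l = 0"
    using assms by (auto simp: periodic_space_def)
  have "Q' $ a $ b = Q' $ b $ a" for a b
    using arg_cong[OF s(1), of "\<lambda>A. A $ b $ a"] by (simp add: transpose_def)
  then have "Q \<bullet> Q' = trace (Q ** Q')"
    unfolding inner_vec_def trace_def matrix_matrix_mult_def by simp
  moreover have "t \<bullet> t' = (\<Sum>i\<in>UNIV - {l}. t $ i \<bullet> t' $ i)"
    unfolding inner_vec_def[of t] using s(2) by (simp add: sum.remove[of UNIV l])
  ultimately show ?thesis by simp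
qed

lemma dim_symmetric:
  "dim {Q :: real^'d::finite^'d. transpose Q = Q} = (CARD('d) + 1) choose 2"
proof -
  define M :: "'d set \<Rightarrow> real^'d^'d" where "M s = (\<chi> a b. if {a, b} = s then 1 else 0)" for s
  define P :: "'d set set" where "P = range (\<lambda>(a, b). {a, b})"
  have finP: "finite P" by simp
  have Mne: "M s \<noteq> 0" if "s \<in> P" for s
  proof -
    obtain a b where "s = {a, b}" using \<open>s \<in> P\<close> by (auto simp: P_def)
    then have "M s $ a $ b = 1" by (simp add: M_def)
    then show ?thesis by (metis zero_index zero_neq_one)
  qed
  have orth: "M s \<bullet> M s' = 0" if "s \<noteq> s'" for s s'
  proof -
    have "M s $ a $ b * M s' $ a $ b = 0" for a b
      using that by (auto simp: M_def)
    then show ?thesis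
      unfolding inner_vec_def inner_real_def by (intro sum.neutral ballI)
  qed
  have inj: "inj_on M P"
    using Mne orth by (metis inj_onI inner_eq_zero_iff)
  have ind: "independent (M ` P)"
  proof (rule pairwise_orthogonal_independent)
    show "pairwise orthogonal (M ` P)"
      unfolding pairwise_def orthogonal_def using orth by (metis imageE)
    show "0 \<notin> M ` P" using Mne by (metis imageE)
  qed
  have sp: "span (M ` P) = {Q. transpose Q = Q}"
  proof (intro equalityI)
    have "subspace {Q :: real^'d^'d. transpose Q = Q}"
      by (auto simp: subspace_def transpose_def vec_eq_iff)
    moreover have "M ` P \<subseteq> {Q. transpose Q = Q}"
      by (auto simp: M_def transpose_def vec_eq_iff insert_commute)
    ultimately show "span (M ` P) \<subseteq> {Q. transpose Q = Q}"
      by (rule span_minimal[rotated])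
    show "{Q. transpose Q = Q} \<subseteq> span (M ` P)"
    proof
      fix Q :: "real^'d^'d"
      assume "Q \<in> {Q. transpose Q = Q}"
      then have sym: "Q $ a $ b = Q $ b $ a" for a b
        by (metis (mono_tags) mem_Collect_eq transpose_def vec_lambda_beta)
      define c where "c s = (SOME r. \<exists>a b. s = {a, b} \<and> r = Q $ a $ b)" for s
      have c: "c {a, b} = Q $ a $ b" for a b
        unfolding c_def by (rule some_equality) (auto simp: doubleton_eq_iff sym)
      have "Q = (\<Sum>s\<in>P. c s *\<^sub>R M s)"
      proof (simp add: vec_eq_iff, intro allI)
        fix a b
        have "(\<Sum>s\<in>P. c s * M s $ a $ b) = (\<Sum>s\<in>P. if {a, b} = s then c s else 0)"
          by (intro sum.cong) (auto simp: M_def)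
        also have "\<dots> = c {a, b}"
          using finP by (subst sum.delta') (auto simp: P_def)
        finally show "Q $ a $ b = (\<Sum>s\<in>P. c s * M s $ a $ b)" by (simp add: c)
      qed
      then show "Q \<in> span (M ` P)"
        by (metis (no_types, lifting) image_eqI span_base span_scale span_sum)
    qed
  qed
  have "P = {s. s \<subseteq> UNIV \<and> card s = 1} \<union> {s. s \<subseteq> UNIV \<and> card s = 2}"
    by (auto simp: P_def card_1_singleton_iff card_2_iff card_insert_if)
  moreover have "card \<dots> = (CARD('d) choose 1) + (CARD('d) choose 2)"
    using n_subsets[of "UNIV :: 'd set" 1] n_subsets[of "UNIV :: 'd set" 2]
    by (subst card_Un_disjoint) auto
  ultimately have "card P = (CARD('d) + 1) choose 2"
    by (simp add: numeral_2_eq_2)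
  then show ?thesis
    using ind sp inj by (metis card_image dim_span_eq_card_independent)
qed

lemma dim_periodic_space:
  fixes l :: "'m::finite"
  shows "dim (periodic_space l :: ((real^'d::finite^'d) \<times> (real^'d^'m)) set) =
    ((CARD('d) + 1) choose 2) + (CARD('m) - 1) * CARD('d)"
proof -
  let ?S = "{Q :: real^'d^'d. transpose Q = Q}" and ?T = "{t :: real^'d^'m. t $ l = 0}"
  have S: "subspace ?S"
    by (auto simp: subspace_def transpose_def vec_eq_iff)
  have T: "subspace ?T"
    by (auto simp: subspace_def)
  define B :: "(real^'d^'m) set" where "B = {axis k e | k e. k \<noteq> l \<and> e \<in> Basis}"
  have B: "B \<subseteq> Basis" by (auto simp: B_def Basis_vec_def)
  have Beq: "B = (\<lambda>(k, e). axis k e) ` ((UNIV - {l}) \<times> Basis)" by (auto simp: B_def)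
  have "inj_on (\<lambda>(k, e). axis k e :: real^'d^'m) ((UNIV - {l}) \<times> Basis)"
    by (auto simp: inj_on_def axis_eq_axis nonzero_Basis)
  then have cB: "card B = (CARD('m) - 1) * CARD('d)"
    unfolding Beq by (simp add: card_image card_cartesian_product card_Diff_singleton)
  have spB: "span B = ?T"
  proof (intro equalityI)
    show "span B \<subseteq> ?T"
      using T by (intro span_minimal) (auto simp: B_def axis_def)
    show "?T \<subseteq> span B"
    proof
      fix t assume "t \<in> ?T"
      then have t: "t $ l = 0" by simp
      have "(t \<bullet> b) *\<^sub>R b \<in> span B" if "b \<in> Basis" for b
      proof (cases "b \<in> B")
        case True then show ?thesis by (simp add: span_base span_scale)
      next
        case False
        moreover obtain k e where b: "b = axis k e" "e \<in> Basis"
          using \<open>b \<in> Basis\<close> unfolding Basis_vec_def by blast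
        ultimately have "b = axis l e" unfolding B_def by blast
        then have "t \<bullet> b = 0" using t by (simp add: inner_axis)
        then show ?thesis by (simp add: span_zero)
      qed
      then have "(\<Sum>b\<in>Basis. (t \<bullet> b) *\<^sub>R b) \<in> span B" by (intro span_sum) auto
      then show "t \<in> span B" by (simp add: euclidean_representation)
    qed
  qed
  have "independent B"
    using B independent_Basis independent_mono by blast
  then have "dim ?T = (CARD('m) - 1) * CARD('d)"
    using spB cB by (metis dim_span_eq_card_independent)
  moreover have "periodic_space l = ?S \<times> ?T"
    by (auto simp: periodic_space_def)
  ultimately show ?thesis
    using dim_Times[OF S T] dim_symmetric[where 'd='d] by simp
qed

lemma pgrad_in_periodic_space: "pgrad l i j v X \<in> periodic_space l"
  by (simp add: pgrad_def periodic_space_def Let_def transpose_def vec_eq_iff)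

lemma has_derivative_pval:
  fixes X :: "(real^'d::finite^'d) \<times> (real^'d^'m::finite)"
  assumes X: "X \<in> periodic_space l"
  shows "(pval i j v has_derivative (\<lambda>H. pgrad l i j v X \<bullet> H)) (at X within periodic_space l)"
proof -
  have bb: "bounded_bilinear ((*v) :: real^'d^'d \<Rightarrow> real^'d \<Rightarrow> real^'d)"
    unfolding bilinear_conv_bounded_bilinear[symmetric] bilinear_def
    by (auto intro!: linearI simp: algebra_simps scaleR_matrix_vector_assoc)
  let ?w = "diff_vec X i j v" and ?Q = "fst X"
  let ?D = "\<lambda>H. ?w \<bullet> (?Q *v (snd H $ i - snd H $ j) + fst H *v ?w)
               + (snd H $ i - snd H $ j) \<bullet> (?Q *v ?w)"
  have nth: "((\<lambda>Y. snd Y $ k) has_derivative (\<lambda>H. snd H $ k)) (at X within periodic_space l)" for k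
    by (intro bounded_linear.has_derivative[OF bounded_linear_vec_nth] derivative_eq_intros) auto
  have dw: "((\<lambda>Y. diff_vec Y i j v) has_derivative (\<lambda>H. snd H $ i - snd H $ j))
      (at X within periodic_space l)"
    unfolding diff_vec_def by (auto intro!: derivative_eq_intros nth)
  have D: "(pval i j v has_derivative ?D) (at X within periodic_space l)"
    unfolding pval_def[abs_def] qform_def
    by (rule has_derivative_inner[OF dw
          bounded_bilinear.FDERIV[OF bb has_derivative_fst[OF has_derivative_ident] dw]])
  have eq: "?D H = pgrad l i j v X \<bullet> H" if H: "H \<in> periodic_space l" for H
  proof -
    define w where "w = ?w"
    have Q: "transpose ?Q = ?Q" using X by (auto simp: periodic_space_def)
    have hl: "snd H $ l = 0" using H by (auto simp: periodic_space_def)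
    have sym: "w \<bullet> (?Q *v x) = x \<bullet> (?Q *v w)" for x
      by (metis Q dot_lmul_matrix inner_commute vector_transpose_matrix)
    have 1: "(\<chi> a b. w $ a * w $ b) \<bullet> fst H = w \<bullet> (fst H *v w)"
      by (simp add: inner_vec_def matrix_vector_mult_def sum_distrib_left mult_ac)
    define u where "u = 2 *\<^sub>R (?Q *v w)"
    have "(\<chi> k. if k = l then 0 else (if k = i then u else 0) - (if k = j then u else 0)) \<bullet> snd H
        = (\<Sum>k\<in>UNIV. (if k = i then u \<bullet> snd H $ k else 0) - (if k = j then u \<bullet> snd H $ k else 0))"
      unfolding inner_vec_def[of _ "snd H"]
      by (intro sum.cong refl) (auto simp: hl inner_diff_left)
    also have "\<dots> = u \<bullet> (snd H $ i - snd H $ j)"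
      by (simp add: sum_subtractf inner_diff_right)
    finally have 2: "pgrad l i j v X \<bullet> H = w \<bullet> (fst H *v w) + u \<bullet> (snd H $ i - snd H $ j)"
      unfolding pgrad_def Let_def w_def[symmetric] u_def[symmetric] inner_prod_def by (simp add: 1)
    show ?thesis
      unfolding 2 w_def[symmetric] by (simp add: inner_add_right sym u_def inner_commute)
  qed
  have sub: "Y - X \<in> periodic_space l" if "Y \<in> periodic_space l" for Y
    using that X by (auto simp: periodic_space_def transpose_def vec_eq_iff)
  show ?thesis
    unfolding has_derivative_iff_norm
  proof (intro conjI bounded_linear_inner_right)
    let ?q = "\<lambda>D Y. norm (pval i j v Y - pval i j v X - D (Y - X)) / norm (Y - X)"
    have "(?q ?D \<longlongrightarrow> 0) (at X within periodic_space l)"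
      using D unfolding has_derivative_iff_norm by blast
    moreover have "eventually (\<lambda>Y. ?q ?D Y = ?q (\<lambda>H. pgrad l i j v X \<bullet> H) Y) (at X within periodic_space l)"
      unfolding eventually_at_filter by (intro always_eventually allI impI) (simp only: eq[OF sub])
    ultimately show "(?q (\<lambda>H. pgrad l i j v X \<bullet> H) \<longlongrightarrow> 0) (at X within periodic_space l)"
      by (rule Lim_transform_eventually)
  qed
qed

lemma finite_bounded_int_vecs: "finite {v \<in> int_vecs :: (real^'d::finite) set. norm v \<le> B}"
proof -
  have "(\<lambda>v. vec_nth v) ` {v \<in> int_vecs. norm v \<le> B} \<subseteq> PiE UNIV (\<lambda>_::'d. {x \<in> \<int>. \<bar>x\<bar> \<le> B})"
    by (auto simp: int_vecs_def) (meson component_le_norm_cart order_trans)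
  then have "finite ((\<lambda>v. vec_nth v) ` {v \<in> int_vecs :: (real^'d) set. norm v \<le> B})"
    by (rule finite_subset) (intro finite_PiE finite_abs_int_segment finite)
  then show ?thesis
    by (rule finite_imageD) (simp add: inj_on_def vec_nth_inject)
qed

lemma gen_min_attained:
  fixes X :: "(real^'d::finite^'d) \<times> (real^'d^'m::finite)"
  assumes X: "X \<in> periodic_forms l"
  shows "\<exists>i j v. admissible i j v \<and> gen_min X = pval i j v X"
    and "admissible i j v \<Longrightarrow> gen_min X \<le> pval i j v X"
proof -
  define Q where "Q = fst X"
  define V where "V = {r. \<exists>i j v. admissible i j v \<and> r = pval i j v X}"
  have pos: "qform Q x > 0" if "x \<noteq> 0" for x
    using X that by (auto simp: periodic_forms_def Q_def)
  have cont: "continuous_on (sphere 0 1) (qform Q)"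
    unfolding qform_def by (intro continuous_intros matrix_vector_mult_linear_continuous_on)
  have "sphere (0 :: real^'d) 1 \<noteq> {}" by simp
  then obtain x0 where x0: "x0 \<in> sphere 0 1" "\<And>x. x \<in> sphere 0 1 \<Longrightarrow> qform Q x0 \<le> qform Q x"
    using continuous_attains_inf[OF compact_sphere _ cont] by blast
  define c where "c = qform Q x0"
  have c: "c > 0" using x0(1) unfolding c_def by (intro pos) auto
  have lower: "c * (norm x)\<^sup>2 \<le> qform Q x" for x
  proof (cases "x = 0")
    case False
    have "c \<le> qform Q ((1 / norm x) *\<^sub>R x)" using x0(2) False by (simp add: c_def)
    also have "\<dots> = qform Q x / (norm x)\<^sup>2"
      by (simp add: qform_def matrix_vector_mult_scaleR power2_eq_square)
    finally show ?thesis using False by (simp add: pos_le_divide_eq)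
  qed (simp add: qform_def)
  define i0 :: 'm where "i0 = undefined"
  define r0 where "r0 = pval i0 i0 (\<chi> k. 1) X"
  have "admissible i0 i0 ((\<chi> k. 1) :: real^'d)" by (simp add: admissible_def int_vecs_def vec_eq_iff)
  then have r0: "r0 \<in> V" by (auto simp: V_def r0_def)
  define B where "B = sqrt (r0 / c)"
  define F where "F = (\<Union>i. \<Union>j. (\<lambda>v. pval i j v X) `
      {v \<in> int_vecs. norm v \<le> B + norm (snd X $ i - snd X $ j)})"
  have "finite F"
    unfolding F_def by (intro finite_UN_I finite_imageI finite_bounded_int_vecs) auto
  moreover have "V \<inter> {..r0} \<subseteq> F"
  proof
    fix r assume "r \<in> V \<inter> {..r0}"
    then obtain i j v where r: "admissible i j v" "r = pval i j v X" "r \<le> r0"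
      by (auto simp: V_def)
    have "c * (norm (diff_vec X i j v))\<^sup>2 \<le> r0"
      using lower[of "diff_vec X i j v"] r by (simp add: pval_def Q_def)
    then have "(norm (diff_vec X i j v))\<^sup>2 \<le> r0 / c"
      using c by (simp add: pos_le_divide_eq mult.commute)
    then have "norm (diff_vec X i j v) \<le> B"
      unfolding B_def by (rule real_le_rsqrt)
    moreover have "norm v \<le> norm (diff_vec X i j v) + norm (snd X $ i - snd X $ j)"
      using norm_triangle_ineq4[of "snd X $ i - snd X $ j" "diff_vec X i j v"]
      by (simp add: diff_vec_def)
    ultimately have "norm v \<le> B + norm (snd X $ i - snd X $ j)" by linarith
    then show "r \<in> F" using r by (auto simp: F_def admissible_def)
  qed
  ultimately have fin: "finite (V \<inter> {..r0})" by (rule finite_subset[rotated])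
  define r1 where "r1 = Min (V \<inter> {..r0})"
  have ne: "V \<inter> {..r0} \<noteq> {}" using r0 by auto
  have r1: "r1 \<in> V \<inter> {..r0}" unfolding r1_def by (rule Min_in[OF fin ne])
  have least: "r1 \<le> r" if "r \<in> V" for r
  proof (cases "r \<le> r0")
    case True
    then show ?thesis unfolding r1_def using that by (intro Min_le[OF fin]) auto
  next
    case False
    then show ?thesis using r1 by auto
  qed
  have "gen_min X = (LEAST r. r \<in> V)" by (simp add: gen_min_def V_def)
  also have "\<dots> = r1" using r1 least by (intro Least_equality) auto
  finally have g: "gen_min X = r1" .
  show "\<exists>i j v. admissible i j v \<and> gen_min X = pval i j v X"
    using r1 by (auto simp: g V_def)
  show "admissible i j v \<Longrightarrow> gen_min X \<le> pval i j v X"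
    using least by (auto simp: g V_def)
qed

end

theory Submission
  imports Defs
begin

text \<open>
  Suppose that \<open>X = (Q, t)\<close> is not isolated extreme. As \<open>\<lambda>(X) > 0\<close>, a form \<open>X'\<close> with
  \<open>\<lambda>(X') = \<lambda>(X)\<close> and \<open>det X' > det X\<close> has smaller density. So there are forms \<open>X\<^sub>n \<noteq> X\<close> that
  converge to \<open>X\<close> and satisfy \<open>\<lambda>(X\<^sub>n) = \<lambda>(X)\<close> and \<open>det X\<^sub>n \<le> det X\<close>. By compactness of the unit
  sphere one may assume that the normalised differences \<open>X\<^sub>n - X\<close> converge to a unit vector \<open>h\<close>
  of \<open>S\<^sup>d\<^sup>,\<^sup>m\<close>.

  First-order information about \<open>h\<close> already contradicts the hypotheses. If the polynomial
  \<open>p\<close> attains the minimum at \<open>X\<close>, then \<open>p(X\<^sub>n) \<ge> \<lambda>(X\<^sub>n) = p(X)\<close>, so \<open>h\<close> has a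
  nonnegative inner product with the gradient of \<open>p\<close> at \<open>X\<close>
  (\<open>has_derivative_nonneg_tangent\<close>). The same argument for
  \<open>-det\<close>, whose gradient at \<open>X\<close> is \<open>-det Q \<cdot> (Q\<^sup>-\<^sup>1, 0)\<close> (\<open>has_derivative_det\<close>),
  shows that the inner product of \<open>(Q\<^sup>-\<^sup>1, 0)\<close> with \<open>h\<close> is at most \<open>0\<close>.
  But \<open>(Q\<^sup>-\<^sup>1, 0)\<close> lies in the relative interior of the cone generated by the gradients, which by
  perfection spans \<open>S\<^sup>d\<^sup>,\<^sup>m\<close>, so this inner product must be positive
  (\<open>inner_pos_if_rel_interior_convex_cone\<close>).

  For \<open>i \<noteq> j\<close> the polynomials \<open>p\<close> are not linear in \<open>X\<close>, in contrast to the classical case of lattices,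
  but this is harmless: perfection and eutaxy make the inequality strict in first order,
  where terms of second order do not matter.
\<close>

section \<open>One-sided bounds along a convergent sequence\<close>

text \<open>
  The first-order condition for a local minimum, for a sequence in place of a curve: \<open>D h\<close> is the
  limit of the difference quotients of \<open>f\<close> along \<open>y\<close>.
\<close>

lemma has_derivative_nonneg_tangent:
  fixes f :: "'a::real_normed_vector \<Rightarrow> real"
  assumes D: "(f has_derivative D) (at x within S)"
    and y: "\<And>n. y n \<in> S" "\<And>n. y n \<noteq> x" "y \<longlonglongrightarrow> x"
    and f: "\<And>n. f x \<le> f (y n)"
    and h: "(\<lambda>n. (y n - x) /\<^sub>R norm (y n - x)) \<longlonglongrightarrow> h"
  shows "0 \<le> D h"
proof -
  have bl: "bounded_linear D" and
    lim: "((\<lambda>z. ((f z - f x) - D (z - x)) /\<^sub>R norm (z - x)) \<longlongrightarrow> 0) (at x within S)"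
    using D by (auto simp: has_derivative_at_within)
  have "filterlim y (at x within S) sequentially"
    using y by (auto simp: filterlim_at)
  from filterlim_compose[OF lim this]
  have "(\<lambda>n. ((f (y n) - f x) - D (y n - x)) /\<^sub>R norm (y n - x)) \<longlonglongrightarrow> 0" .
  moreover have "(\<lambda>n. D ((y n - x) /\<^sub>R norm (y n - x))) \<longlonglongrightarrow> D h"
    by (rule bounded_linear.tendsto[OF bl h])
  ultimately have "(\<lambda>n. ((f (y n) - f x) - D (y n - x)) /\<^sub>R norm (y n - x)
      + D ((y n - x) /\<^sub>R norm (y n - x))) \<longlonglongrightarrow> 0 + D h"
    by (rule tendsto_add)
  moreover have "((f z - f x) - D (z - x)) /\<^sub>R norm (z - x) + D ((z - x) /\<^sub>R norm (z - x))
      = (f z - f x) / norm (z - x)" for z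
  proof -
    have "D ((z - x) /\<^sub>R norm (z - x)) = D (z - x) / norm (z - x)"
      by (simp only: linear_simps(5)[OF bl]) (simp add: divide_inverse mult.commute)
    then show ?thesis
      by (simp add: divide_inverse algebra_simps del: scaleR_diff_right)
  qed
  ultimately have "(\<lambda>n. (f (y n) - f x) / norm (y n - x)) \<longlonglongrightarrow> D h" by simp
  then show ?thesis
    by (rule LIMSEQ_le_const) (use f in auto)
qed

section \<open>The determinant as a function of the matrix\<close>

text \<open>
  In the Leibniz formula only the identity permutation contributes: any other permutation moves at
  least two indices, so its product has two factors that vanish at the identity matrix.
\<close>

lemma has_derivative_det_mat_1:
  "(det has_derivative trace) (at (mat 1 :: real^'n^'n))"
proof -
  have entry: "((\<lambda>A :: real^'n^'n. A $ i $ j) has_derivative (\<lambda>K. K $ i $ j)) (at A)" for i j A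
    by (intro bounded_linear_imp_has_derivative
        bounded_linear_compose[OF bounded_linear_vec_nth bounded_linear_vec_nth])
  define T where "T p K = (\<Sum>i\<in>UNIV. K $ i $ p i * (\<Prod>j\<in>UNIV - {i}. (mat 1 :: real^'n^'n) $ j $ p j))"
    for p :: "'n \<Rightarrow> 'n" and K :: "real^'n^'n"
  have "(det has_derivative (\<lambda>K. \<Sum>p | p permutes UNIV. of_int (sign p) * T p K)) (at (mat 1))"
    unfolding det_def[abs_def] T_def
    by (intro has_derivative_sum has_derivative_mult_right has_derivative_prod entry)
  moreover have "(\<Sum>p | p permutes UNIV. of_int (sign p) * T p K) = trace K" for K
  proof -
    have zero: "T p K = 0" if p: "p permutes UNIV" "p \<noteq> id" for p
      unfolding T_def
    proof (rule sum.neutral, intro ballI)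
      fix i
      \<comment> \<open>Both \<open>a\<close> and \<open>p a\<close> are moved, and one of them differs from the differentiated row.\<close>
      obtain a where a: "p a \<noteq> a" using p(2) by fastforce
      have "p (p a) \<noteq> p a" using a permutes_inj[OF p(1)] by (auto dest: injD)
      then obtain j where "j \<noteq> i" "p j \<noteq> j" using a by metis
      then have "(\<Prod>j\<in>UNIV - {i}. (mat 1 :: real^'n^'n) $ j $ p j) = 0"
        by (intro prod_zero) (auto simp: mat_def intro!: bexI[of _ j])
      then show "K $ i $ p i * (\<Prod>j\<in>UNIV - {i}. (mat 1 :: real^'n^'n) $ j $ p j) = 0" by simp
    qed
    have "(\<Sum>p | p permutes UNIV. of_int (sign p) * T p K)
        = (\<Sum>p\<in>{id}. of_int (sign p) * T p K)"
      by (rule sum.mono_neutral_right) (auto simp: zero permutes_id)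
    also have "\<dots> = trace K"
      by (simp add: T_def trace_def mat_def)
    finally show ?thesis .
  qed
  ultimately show ?thesis by (simp add: fun_eq_iff)
qed

lemma matrix_inv_inverse:
  fixes A :: "real^'n^'n"
  assumes "invertible A"
  shows matrix_inv_mult_right: "A ** matrix_inv A = mat 1"
    and matrix_inv_mult_left: "matrix_inv A ** A = mat 1"
  using someI_ex[OF assms[unfolded invertible_def]] by (simp_all add: matrix_inv_def)

text \<open>
  Jacobi's formula at an invertible matrix follows from its case at the identity by
  \<open>det B = det A \<cdot> det (A\<^sup>-\<^sup>1 B)\<close>.
\<close>

lemma has_derivative_det:
  fixes A :: "real^'n^'n"
  assumes "invertible A"
  shows "(det has_derivative (\<lambda>K. det A * trace (matrix_inv A ** K))) (at A)"
proof -
  let ?L = "\<lambda>B. matrix_inv A ** B"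
  have "linear ?L"
    by (auto intro!: linearI simp: matrix_add_ldistrib matrix_scalar_ac scalar_matrix_assoc[symmetric])
  then have "(?L has_derivative ?L) (at A)"
    by (intro bounded_linear_imp_has_derivative) (simp add: linear_conv_bounded_linear)
  moreover have "(det has_derivative trace) (at (?L A))"
    using has_derivative_det_mat_1 by (simp add: matrix_inv_mult_left[OF assms])
  ultimately have "((\<lambda>B. det (?L B)) has_derivative (\<lambda>K. trace (?L K))) (at A)"
    by (rule has_derivative_compose)
  then have "((\<lambda>B. det A * det (?L B)) has_derivative (\<lambda>K. det A * trace (?L K))) (at A)"
    by (rule has_derivative_mult_right)
  moreover have "det A * det (?L B) = det B" for B
    by (metis assms det_mul matrix_inv_mult_right matrix_mul_assoc matrix_mul_lid)
  ultimately show ?thesis by simp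
qed

lemma invertible_if_positive_definite:
  fixes A :: "real^'n^'n"
  assumes "\<And>x. x \<noteq> 0 \<Longrightarrow> 0 < qform A x"
  shows "invertible A"
proof -
  have "A *v x = 0 \<Longrightarrow> x = 0" for x
    using assms[of x] by (auto simp: qform_def)
  then show ?thesis
    by (metis invertible_left_inverse matrix_left_invertible_ker)
qed

text \<open>
  On the segment from the identity matrix to \<open>A\<close> all matrices are positive definite, hence
  invertible, so the determinant cannot change its sign there.
\<close>

lemma det_pos_if_positive_definite:
  fixes A :: "real^'n^'n"
  assumes pos: "\<And>x. x \<noteq> 0 \<Longrightarrow> 0 < qform A x"
  shows "0 < det A"
proof (rule ccontr)
  assume "\<not> 0 < det A"
  let ?P = "\<lambda>s::real. (1 - s) *\<^sub>R mat 1 + s *\<^sub>R A"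
  have inv: "invertible (?P s)" if "0 \<le> s" "s \<le> 1" for s
  proof (rule invertible_if_positive_definite)
    fix x :: "real^'n" assume x: "x \<noteq> 0"
    have "qform (?P s) x = (1 - s) * (x \<bullet> x) + s * qform A x"
      by (simp add: qform_def matrix_vector_mult_add_rdistrib inner_add_right
          scaleR_matrix_vector_assoc[symmetric])
    moreover have "0 < x \<bullet> x" "0 < qform A x" using x pos by auto
    ultimately show "0 < qform (?P s) x"
      using that by (cases "s = 0") (auto intro!: add_nonneg_pos mult_nonneg_nonneg)
  qed
  have "isCont (\<lambda>s. det (?P s)) s" if "0 \<le> s" "s \<le> 1" for s
    by (rule isCont_o2[where g = det])
      (auto intro!: continuous_intros has_derivative_continuous[OF has_derivative_det[OF inv]] that)
  moreover have "det (?P 0) = 1" by simp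
  moreover have "det (?P 1) \<le> 0" using \<open>\<not> 0 < det A\<close> by simp
  ultimately obtain s where "0 \<le> s" "s \<le> 1" "det (?P s) = 0"
    using IVT2[of "\<lambda>s. det (?P s)" 1 0 0] by auto
  then show False using inv invertible_det_nz by blast
qed

section \<open>Relative interior points of a cone\<close>

text \<open>
  A functional that is nonnegative on the generators is nonnegative on the whole cone. The point
  \<open>e\<close> can be moved a little in the direction \<open>-h\<close> without leaving the cone, which strictly
  decreases the functional, so its value at \<open>e\<close> itself is positive.
\<close>

lemma inner_pos_if_rel_interior_convex_cone:
  fixes e :: "'a::euclidean_space"
  assumes e: "e \<in> rel_interior (convex_cone hull G)"
    and h: "h \<in> span (convex_cone hull G)" "h \<noteq> 0"
    and G: "\<And>g. g \<in> G \<Longrightarrow> 0 \<le> g \<bullet> h"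
  shows "0 < e \<bullet> h"
proof -
  let ?C = "convex_cone hull G"
  have C: "?C \<subseteq> {y. 0 \<le> h \<bullet> y}"
    using G by (intro hull_minimal convex_cone_halfspace_ge) (auto simp: inner_commute)
  have aff: "affine hull ?C = span ?C"
    by (simp add: affine_hull_span_0 convex_cone_hull_contains_0 hull_inc)
  obtain r where r: "r > 0" "cball e r \<inter> span ?C \<subseteq> ?C" and eC: "e \<in> ?C"
    using e unfolding mem_rel_interior_cball aff by blast
  define c where "c = r / norm h"
  have c: "c > 0" using r h by (simp add: c_def)
  have "e - c *\<^sub>R h \<in> cball e r"
    using h(2) r(1) by (simp add: c_def dist_norm)
  moreover have "e - c *\<^sub>R h \<in> span ?C"
    by (intro span_diff span_scale h span_base eC)
  ultimately have "0 \<le> h \<bullet> (e - c *\<^sub>R h)" using r C by blast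
  then have "c * (h \<bullet> h) \<le> e \<bullet> h" by (simp add: inner_diff_right inner_commute)
  moreover have "0 < c * (h \<bullet> h)" using c h by simp
  ultimately show ?thesis by linarith
qed

section \<open>Perfect and eutactic periodic forms\<close>

lemma inner_symmetric_eq_trace:
  fixes A B :: "real^'n^'n"
  assumes "transpose B = B"
  shows "A \<bullet> B = trace (A ** B)"
proof -
  have "B $ a $ b = B $ b $ a" for a b
    using arg_cong[OF assms, of "\<lambda>M. M $ b $ a"] by (simp add: transpose_def)
  then show ?thesis
    unfolding inner_vec_def trace_def matrix_matrix_mult_def by simp
qed

lemma subspace_periodic_space: "subspace (periodic_space l)"
  by (auto simp: subspace_def periodic_space_def transpose_def vec_eq_iff zero_prod_def)

lemma span_voronoi_domain_if_m_perfect: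
  fixes X :: "(real^'d::finite^'d) \<times> (real^'d^'m::finite)"
  assumes "m_perfect l X"
  shows "span (voronoi_domain l X) = periodic_space l"
proof -
  have "convex_cone (periodic_space l :: ((real^'d^'d) \<times> (real^'d^'m)) set)"
    by (rule subspace_imp_convex_cone[OF subspace_periodic_space])
  then have "voronoi_domain l X \<subseteq> periodic_space l"
    unfolding voronoi_domain_def by (intro hull_minimal) (auto simp: pgrad_in_periodic_space)
  then have "span (voronoi_domain l X) \<subseteq> periodic_space l"
    by (rule span_minimal[OF _ subspace_periodic_space])
  then show ?thesis
    using assms by (intro subspace_dim_equal subspace_span subspace_periodic_space)
      (auto simp: m_perfect_def dim_span)
qed

text \<open>
  Coinciding translates give \<open>\<lambda>(X) = 0\<close>, which eutaxy excludes: every generator of the Voronoi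
  domain has inner product \<open>\<lambda>(X)\<close> with \<open>(Q, 0)\<close>, whereas \<open>(Q\<^sup>-\<^sup>1, 0)\<close>, a point of
  the domain, has inner product \<open>d > 0\<close> with it.
\<close>

lemma gen_min_pos_if_m_eutactic:
  fixes X :: "(real^'d::finite^'d) \<times> (real^'d^'m::finite)"
  assumes X: "X \<in> periodic_forms l" and eut: "m_eutactic l X"
  shows "0 < gen_min X"
proof (rule ccontr)
  assume neg: "\<not> 0 < gen_min X"
  let ?E = "(matrix_inv (fst X), 0) :: (real^'d^'d) \<times> (real^'d^'m)"
    and ?H = "(fst X, 0) :: (real^'d^'d) \<times> (real^'d^'m)"
  have inv: "invertible (fst X)"
    using X by (intro invertible_if_positive_definite) (auto simp: periodic_forms_def)
  have "pgrad l i j v X \<bullet> ?H = pval i j v X" for i j v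
    by (simp add: pgrad_def Let_def pval_def qform_def inner_vec_def matrix_vector_mult_def
        sum_distrib_left mult_ac)
  then have "{pgrad l i j v X | i j v. admissible i j v \<and> diff_vec X i j v \<in> Min_vecs X}
      \<subseteq> {y. ?H \<bullet> y \<le> 0}"
    using neg by (auto simp: Min_vecs_def pval_def inner_commute)
  then have "voronoi_domain l X \<subseteq> {y. ?H \<bullet> y \<le> 0}"
    unfolding voronoi_domain_def by (rule hull_minimal) (rule convex_cone_halfspace_le)
  moreover have "?E \<in> voronoi_domain l X"
    using eut rel_interior_subset by (auto simp: m_eutactic_def)
  ultimately have "?E \<bullet> ?H \<le> 0" by (auto simp: inner_commute)
  moreover have "?E \<bullet> ?H = trace (matrix_inv (fst X) ** fst X)"
    using X by (auto simp: periodic_forms_def periodic_space_def inner_symmetric_eq_trace)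
  then have "?E \<bullet> ?H = real CARD('d)"
    by (simp add: matrix_inv_mult_left[OF inv] trace_def mat_def)
  ultimately show False by simp
qed

lemma density_less_if_det_less:
  fixes X Y :: "(real^'d::finite^'d) \<times> (real^'d^'m::finite)"
  assumes "gen_min Y = gen_min X" "0 < gen_min X" "0 < det (fst X)" "det (fst X) < det (fst Y)"
  shows "density Y < density X"
proof -
  have "det (fst X) powr (1 / real CARD('d)) < det (fst Y) powr (1 / real CARD('d))"
    using assms by (intro powr_less_mono2) auto
  then have "(gen_min Y / det (fst Y) powr (1 / real CARD('d))) powr (real CARD('d) / 2)
      < (gen_min X / det (fst X) powr (1 / real CARD('d))) powr (real CARD('d) / 2)"
    unfolding assms(1) using assms(2-4)
    by (intro powr_less_mono2 divide_strict_left_mono) auto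
  moreover have "0 < real CARD('m) * measure lborel (cball (0 :: real^'d) 1) / 2 ^ CARD('d)"
    by (simp add: content_cball_pos)
  ultimately show ?thesis
    unfolding density_def by (rule mult_strict_right_mono)
qed

theorem theorem5:
  fixes l :: "'m::finite"
    and X :: "(real^'d::finite^'d) \<times> (real^'d^'m)"
  assumes "X \<in> periodic_forms l"
    and "m_perfect l X"
    and "m_eutactic l X"
  shows "isolated_m_extreme l X"
proof (rule ccontr)
  assume not_isolated: "\<not> isolated_m_extreme l X"
  let ?F = "periodic_forms l :: ((real^'d^'d) \<times> (real^'d^'m)) set"
    and ?S = "periodic_space l :: ((real^'d^'d) \<times> (real^'d^'m)) set"
  let ?E = "(matrix_inv (fst X), 0) :: (real^'d^'d) \<times> (real^'d^'m)"
  have FS: "?F \<subseteq> ?S" by (auto simp: periodic_forms_def)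
  have posdef: "x \<noteq> 0 \<Longrightarrow> 0 < qform (fst X) x" for x
    using assms(1) by (auto simp: periodic_forms_def)
  note inv = invertible_if_positive_definite[OF posdef]
  note det_pos = det_pos_if_positive_definite[OF posdef]
  note min_pos = gen_min_pos_if_m_eutactic[OF assms(1,3)]
  have "\<exists>Y\<in>?F. dist Y X < r \<and> Y \<noteq> X \<and> gen_min Y = gen_min X \<and> det (fst Y) \<le> det (fst X)"
    if "r > 0" for r
  proof -
    have "openin (top_of_set ?F) (?F \<inter> ball X r)" by (simp add: openin_open_Int)
    moreover have "X \<in> ?F \<inter> ball X r" using assms(1) that by simp
    ultimately obtain Y where Y: "Y \<in> ?F \<inter> ball X r" "Y \<noteq> X" "gen_min Y = gen_min X"
        "\<not> density Y < density X"
      using not_isolated unfolding isolated_m_extreme_def by blast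
    then have "det (fst Y) \<le> det (fst X)"
      using density_less_if_det_less[OF Y(3) min_pos det_pos] by fastforce
    then show ?thesis using Y by (auto simp: dist_commute)
  qed
  then have "\<forall>n. \<exists>Y\<in>?F. dist Y X < 1 / real (Suc n) \<and> Y \<noteq> X \<and> gen_min Y = gen_min X
      \<and> det (fst Y) \<le> det (fst X)" by simp
  then obtain Y where Y: "\<And>n. Y n \<in> ?F" "\<And>n. dist (Y n) X < 1 / real (Suc n)" "\<And>n. Y n \<noteq> X"
      "\<And>n. gen_min (Y n) = gen_min X" "\<And>n. det (fst (Y n)) \<le> det (fst X)"
    by metis
  have YX: "Y \<longlonglongrightarrow> X"
    using Y(2) by (intro metric_tendsto_imp_tendsto[OF LIMSEQ_inverse_real_of_nat])
      (auto simp: inverse_eq_divide intro!: always_eventually less_imp_le)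
  let ?u = "\<lambda>Z. (Z - X) /\<^sub>R norm (Z - X)"
  have "?u (Y n) \<in> sphere 0 1" for n using Y(3) by simp
  then obtain h \<sigma> where h: "h \<in> sphere 0 1" and \<sigma>: "strict_mono \<sigma>"
      and lim: "((\<lambda>n. ?u (Y n)) \<circ> \<sigma>) \<longlonglongrightarrow> h"
    using compact_sphere[of 0 1, unfolded compact_def, rule_format, of "\<lambda>n. ?u (Y n)"] by blast
  define Z where "Z = Y \<circ> \<sigma>"
  have Z: "Z n \<in> ?F" "Z n \<in> ?S" "Z n \<noteq> X" "gen_min (Z n) = gen_min X"
      "det (fst (Z n)) \<le> det (fst X)" for n
    using Y FS by (auto simp: Z_def)
  have ZX: "Z \<longlonglongrightarrow> X" unfolding Z_def by (rule LIMSEQ_subseq_LIMSEQ[OF YX \<sigma>])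
  have Zh: "(\<lambda>n. ?u (Z n)) \<longlonglongrightarrow> h" using lim by (simp add: Z_def o_def)
  have XS: "X \<in> ?S" using assms(1) FS by blast
  have hS: "h \<in> ?S"
    using Lim_in_closed_set[OF closed_subspace[OF subspace_periodic_space] _ _ Zh]
    by (simp add: subspace_periodic_space subspace_diff subspace_scale Z(2) XS)
  have "0 \<le> pgrad l i j v X \<bullet> h" if ij: "admissible i j v" "diff_vec X i j v \<in> Min_vecs X" for i j v
  proof (rule has_derivative_nonneg_tangent[OF has_derivative_pval[OF XS] Z(2,3) ZX _ Zh])
    fix n
    have "pval i j v X = gen_min (Z n)"
      using ij(2) by (auto simp: Min_vecs_def pval_def Z(4))
    also have "\<dots> \<le> pval i j v (Z n)" by (rule gen_min_attained(2)[OF Z(1) ij(1)])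
    finally show "pval i j v X \<le> pval i j v (Z n)" .
  qed
  then have "0 < ?E \<bullet> h"
    using assms(3) h hS unfolding m_eutactic_def voronoi_domain_def
    by (intro inner_pos_if_rel_interior_convex_cone)
      (auto simp: span_voronoi_domain_if_m_perfect[OF assms(2), unfolded voronoi_domain_def])
  moreover have "?E \<bullet> h = trace (matrix_inv (fst X) ** fst h)"
    using hS by (cases h) (auto simp: periodic_space_def inner_symmetric_eq_trace)
  moreover have "0 \<le> - (det (fst X) * trace (matrix_inv (fst X) ** fst h))"
  proof (rule has_derivative_nonneg_tangent[OF _ Z(2,3) ZX _ Zh])
    show "((\<lambda>Z. - det (fst Z)) has_derivative
        (\<lambda>K. - (det (fst X) * trace (matrix_inv (fst X) ** fst K)))) (at X within ?S)"
      by (intro has_derivative_minus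
          has_derivative_compose[OF has_derivative_fst[OF has_derivative_ident] has_derivative_det[OF inv]])
    show "- det (fst X) \<le> - det (fst (Z n))" for n using Z(5) by simp
  qed
  ultimately show False
    using det_pos by (simp add: mult_le_0_iff)
qed

end
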